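(* Let $a$, $b$ and $n$ be positive integers with $a>b$. Then $$(2bn+1)(2bn+3)\binom{2bn}{bn} \ \text{ divides } \ 3(a-b)(3a-b)\binom{2an}{an}\binom{an}{bn}.$$ *)

theory Defs
  imports Complex_Main
begin

end

theory Submission
  imports Defs "HOL-Computational_Algebra.Primes"
begin

text \<open>
  Put \<open>A = an\<close>, \<open>B = bn\<close>, \<open>m = A - B\<close>. The quotient
  \<open>Q B m = (2A choose A) (A choose B) / (2B choose B)\<close> equals
  \<open>4^m (B + m - 1/2 choose m)\<close>; Pascal's rule turns this into a recurrence with integer
  coefficients, so it is an integer. It satisfies \<open>m Q B m = 2 (2B + 1) Q (B + 1) (m - 1)\<close>, whence
  \<open>2B + 1\<close> divides \<open>m Q B m\<close> and \<open>2B + 3\<close> divides \<open>m (m - 1) Q B m\<close>. The factors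
  \<open>n\<close> in \<open>m = (a - b) n\<close> and in \<open>3 (m - 1) \<equiv> (3a - b) n (mod 2B + 3)\<close> can be cancelled up to
  a factor 3, because \<open>n\<close> is coprime to \<open>2bn + 1\<close> and has at most the divisor 3 in common
  with \<open>2bn + 3\<close>.
\<close>

text \<open>The recurrence itself is the definition, so values are natural numbers by construction.
  Row 0 is 4^m (m - 1/2 choose m), the central binomial coefficient.\<close>

fun central_quot :: "nat \<Rightarrow> nat \<Rightarrow> nat" where
  "central_quot 0 m = (2 * m) choose m"
| "central_quot (Suc B) 0 = 1"
| "central_quot (Suc B) (Suc m) = central_quot B (Suc m) + 4 * central_quot (Suc B) m"

lemma central_binomial_Suc:
  "Suc m * ((2 * Suc m) choose Suc m) = 2 * (2 * m + 1) * ((2 * m) choose m)"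
proof -
  have 1: "Suc m * ((2 * Suc m) choose Suc m) = (2 * m + 2) * ((2 * m + 1) choose m)"
    using Suc_times_binomial_eq[of "2 * m + 1" m] by (simp add: mult.commute)
  have "Suc m * ((2 * m + 1) choose m) = (2 * m + 1) * ((2 * m) choose m)"
    using binomial_absorb_comp[of "2 * m + 1" m] by simp
  with 1 show ?thesis by (simp add: algebra_simps)
qed

lemma central_quot_0_right: "central_quot B 0 = 1"
  by (cases B) auto

lemma central_quot_1_right: "central_quot B (Suc 0) = 2 * (2 * B + 1)"
  by (induction B) (auto simp: central_quot_0_right)

lemma central_quot_1_left: "central_quot (Suc 0) m = (2 * m + 1) * ((2 * m) choose m)"
proof (induction m)
  case (Suc m)
  have "central_quot (Suc 0) (Suc m)
      = ((2 * Suc m) choose Suc m) + 2 * (2 * (2 * m + 1) * ((2 * m) choose m))"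
    by (simp add: Suc)
  also have "\<dots> = (2 * Suc m + 1) * ((2 * Suc m) choose Suc m)"
    unfolding central_binomial_Suc[symmetric] by (simp only: algebra_simps)
  finally show ?case .
qed simp

text \<open>Informally, \<open>central_quot B m\<close> is 2^m (2B+1)(2B+3)...(2B+2m-1) / m!; here
  the lowest odd factor is split off. The proof from the recurrence is a double induction, on
  \<open>B\<close> and then on \<open>m\<close>.\<close>

lemma central_quot_shift:
  "Suc m * central_quot B (Suc m) = 2 * (2 * B + 1) * central_quot (Suc B) m"
proof (induction B arbitrary: m)
  case 0
  show ?case
    using central_binomial_Suc[of m] by (simp add: central_quot_1_left)
next
  case (Suc B)
  show ?case
  proof (induction m)
    case 0
    show ?case by (simp add: central_quot_1_right central_quot_0_right del: central_quot.simps)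
  next
    case step: (Suc m)
    define x where "x = central_quot (Suc B) (Suc m)"
    define y where "y = central_quot (Suc (Suc B)) m"
    have "Suc (Suc m) * central_quot (Suc B) (Suc (Suc m))
        = Suc (Suc m) * central_quot B (Suc (Suc m)) + 4 * (Suc (Suc m) * x)"
      by (simp add: x_def algebra_simps)
    \<comment> \<open>The outer hypothesis is used at \<open>Suc m\<close>. One \<open>4 * x\<close>
      is set aside: it raises the coefficient \<open>2 * (2 * B + 1)\<close> to
      \<open>2 * (2 * Suc B + 1)\<close>, and the rest fits the inner hypothesis.\<close>
    also have "\<dots> = 2 * (2 * B + 1) * x + 4 * x + 4 * (Suc m * x)"
      unfolding Suc.IH x_def[symmetric] by simp
    also have "Suc m * x = 2 * (2 * Suc B + 1) * y"
      using step by (simp only: x_def y_def)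
    also have "2 * (2 * B + 1) * x + 4 * x + 4 * (2 * (2 * Suc B + 1) * y)
        = 2 * (2 * Suc B + 1) * (x + 4 * y)"
      by (simp add: algebra_simps)
    also have "x + 4 * y = central_quot (Suc (Suc B)) (Suc m)"
      by (simp add: x_def y_def)
    finally show ?case .
  qed
qed

text \<open>Passing from \<open>(B, Suc m)\<close> to \<open>(Suc B, m)\<close> keeps the sum, hence
  the first binomial. Multiplied by \<open>Suc m\<close>, the other factors change by absorption,
  \<open>central_binomial_Suc\<close> and \<open>central_quot_shift\<close>.\<close>

lemma central_quot_mult_central_binomial:
  "((2 * (B + m)) choose (B + m)) * ((B + m) choose B) = central_quot B m * ((2 * B) choose B)"
proof (induction m arbitrary: B)
  case 0
  show ?case by (simp add: central_quot_0_right)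
next
  case (Suc m)
  let ?C = "(2 * (B + Suc m)) choose (B + Suc m)"
  have absorb: "Suc m * ((B + Suc m) choose B) = Suc B * ((B + Suc m) choose Suc B)"
    using binomial_absorb_comp[of "B + Suc m" B] binomial_absorption[of B "B + Suc m"]
    by simp
  have "Suc m * (?C * ((B + Suc m) choose B)) = Suc B * (?C * ((B + Suc m) choose Suc B))"
    using absorb by (metis mult.left_commute)
  also have "\<dots> = central_quot (Suc B) m * (Suc B * ((2 * Suc B) choose Suc B))"
    using Suc[of "Suc B"] by (simp add: algebra_simps del: binomial_Suc_Suc)
  also have "\<dots> = Suc m * (central_quot B (Suc m) * ((2 * B) choose B))"
    unfolding central_binomial_Suc mult.assoc[of "Suc m", symmetric] central_quot_shift
    by (simp only: mult_ac)
  finally show ?case by (simp only: mult_cancel1) simp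
qed

lemma central_quot_dvd1: "2 * B + 1 dvd m * central_quot B m"
proof (cases m)
  case (Suc k)
  show ?thesis
    unfolding Suc central_quot_shift by (intro dvd_mult2 dvd_mult dvd_refl)
qed simp

text \<open>After one shift, \<open>central_quot_dvd1\<close> applies at \<open>Suc B\<close>, whose
  modulus is 2(B+1) + 1 = 2B + 3.\<close>

lemma central_quot_dvd2: "2 * B + 3 dvd m * (m - 1) * central_quot B m"
proof (cases m)
  case (Suc k)
  have "m * (m - 1) * central_quot B m = k * (Suc k * central_quot B (Suc k))"
    using Suc by (simp add: algebra_simps)
  also have "\<dots> = 2 * (2 * B + 1) * (k * central_quot (Suc B) k)"
    unfolding central_quot_shift by (simp only: mult_ac)
  finally show ?thesis
    using central_quot_dvd1[of "Suc B" k] by (simp add: numeral_3_eq_3)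
qed simp

lemma coprime_mult_add_iff: "coprime (c * n + r) n \<longleftrightarrow> coprime r n" for c n r :: nat
  by (metis add.commute gcd_add_mult gcd.commute coprime_iff_gcd_eq_1 mult.commute)

theorem theorem1:
  fixes a b n :: nat
  assumes "a > 0" and "b > 0" and "n > 0" and "a > b"
  shows "(2 * b * n + 1) * (2 * b * n + 3) * ((2 * b * n) choose (b * n)) dvd
         3 * (a - b) * (3 * a - b) * ((2 * a * n) choose (a * n)) * ((a * n) choose (b * n))"
proof -
  define d where "d = a - b"
  define Q where "Q = central_quot (b * n) (d * n)"
  have a: "a = b + d" using assms by (simp add: d_def)
  have d0: "d > 0" using assms by (simp add: d_def)
  have e: "3 * a - b = 2 * b + 3 * d" by (simp add: a)
  have id: "((2 * a * n) choose (a * n)) * ((a * n) choose (b * n)) = Q * ((2 * b * n) choose (b * n))"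
    using central_quot_mult_central_binomial[of "b * n" "d * n"]
    by (simp add: Q_def a algebra_simps)
  have cop1: "coprime (2 * b * n + 1) n"
    by (simp only: coprime_mult_add_iff coprime_1_left)
  have one: "2 * b * n + 1 dvd d * Q"
  proof -
    have "2 * b * n + 1 dvd n * (d * Q)"
      using central_quot_dvd1[of "b * n" "d * n"] by (simp add: Q_def mult_ac)
    then show ?thesis using cop1 coprime_dvd_mult_right_iff by blast
  qed
  have two: "2 * b * n + 3 dvd d * n * (d * n - 1) * Q"
    using central_quot_dvd2[of "b * n" "d * n"] by (simp add: Q_def mult_ac)
  have dn: "d * n \<ge> 1" using d0 assms by simp
  have three: "2 * b * n + 3 dvd 3 * d * (2 * b + 3 * d) * Q"
  proof (cases "3 dvd n")
    case True
    then obtain k where k: "n = 3 * k" by auto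
    \<comment> \<open>The modulus 2bn + 3 is now 3(2bk + 1). Its 3 cancels against the one in
      \<open>n\<close> and is restored at the end by the 3 in the goal.\<close>
    have "3 * (2 * b * k + 1) dvd 3 * (k * (d * (d * n - 1) * Q))"
      using two by (simp add: k algebra_simps)
    then have "2 * b * k + 1 dvd k * (d * (d * n - 1) * Q)"
      by (rule dvd_mult_cancel) simp
    moreover have copk: "coprime (2 * b * k + 1) k"
      by (simp only: coprime_mult_add_iff coprime_1_left)
    ultimately have "2 * b * k + 1 dvd d * (d * n - 1) * Q"
      using coprime_dvd_mult_right_iff by blast
    \<comment> \<open>Adding this multiple of the modulus turns dn - 1 into 3dk + 2bk, which exposes
      a second factor \<open>k\<close> to cancel.\<close>
    then have "2 * b * k + 1 dvd d * (d * n - 1) * Q + (2 * b * k + 1) * (d * Q)"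
      by (intro dvd_add dvd_triv_left)
    also have "d * (d * n - 1) * Q + (2 * b * k + 1) * (d * Q) = d * Q * ((d * n - 1) + 1 + 2 * b * k)"
      by (simp add: algebra_simps)
    also have "(d * n - 1) + 1 + 2 * b * k = k * (2 * b + 3 * d)"
      using dn by (simp add: k algebra_simps)
    finally have "2 * b * k + 1 dvd k * (d * (2 * b + 3 * d) * Q)"
      by (simp add: mult_ac)
    then have "2 * b * k + 1 dvd d * (2 * b + 3 * d) * Q"
      using copk coprime_dvd_mult_right_iff by blast
    then have "3 * (2 * b * k + 1) dvd 3 * (d * (2 * b + 3 * d) * Q)"
      by (rule mult_dvd_mono[OF dvd_refl])
    then show ?thesis by (simp add: k algebra_simps)
  next
    case False
    have "coprime (2 * b * n + 3) n"
    proof -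
      have "prime (3::nat)" by simp
      then have "coprime 3 n" using False prime_imp_coprime by blast
      then show ?thesis by (simp only: coprime_mult_add_iff)
    qed
    moreover have "2 * b * n + 3 dvd n * (n * (d * (2 * b + 3 * d) * Q))"
    proof -
      \<comment> \<open>Since 3(dn - 1) + (2bn + 3) = n(2b + 3d), a second factor \<open>n\<close>
        appears.\<close>
      have "2 * b * n + 3 dvd 3 * (d * n * (d * n - 1) * Q) + (2 * b * n + 3) * (d * n * Q)"
        by (intro dvd_add dvd_triv_left dvd_mult[OF two])
      also have "3 * (d * n * (d * n - 1) * Q) + (2 * b * n + 3) * (d * n * Q)
        = d * n * Q * (3 * ((d * n - 1) + 1) + 2 * b * n)"
        by (simp add: algebra_simps)
      also have "3 * ((d * n - 1) + 1) + 2 * b * n = n * (2 * b + 3 * d)"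
        using dn by (simp add: algebra_simps)
      finally show ?thesis by (simp add: mult_ac)
    qed
    ultimately have "2 * b * n + 3 dvd d * (2 * b + 3 * d) * Q"
      using coprime_dvd_mult_right_iff by blast
    then show ?thesis by (metis dvd_mult mult.assoc)
  qed
  \<comment> \<open>Consecutive odd numbers are coprime, so the two divisibilities can be
    multiplied.\<close>
  have "coprime (2 * b * n + 1) (2 * b * n + 3)"
  proof -
    have "coprime 2 (2 * b * n + 1)" by (simp add: mult.assoc)
    then show ?thesis
      using coprime_mult_add_iff[of 1 "2 * b * n + 1" 2] by (simp add: coprime_commute numeral_3_eq_3)
  qed
  moreover have "2 * b * n + 1 dvd 3 * d * (2 * b + 3 * d) * Q"
    using dvd_mult[OF one, of "3 * (2 * b + 3 * d)"] by (simp add: mult_ac)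
  ultimately have "(2 * b * n + 1) * (2 * b * n + 3) dvd 3 * d * (2 * b + 3 * d) * Q"
    using three by (intro divides_mult)
  then have "(2 * b * n + 1) * (2 * b * n + 3) * ((2 * b * n) choose (b * n)) dvd
      3 * d * (2 * b + 3 * d) * Q * ((2 * b * n) choose (b * n))"
    by (rule mult_dvd_mono) simp
  also have "\<dots> = 3 * (a - b) * (3 * a - b) *
      (((2 * a * n) choose (a * n)) * ((a * n) choose (b * n)))"
    unfolding id e d_def by (simp add: mult_ac)
  finally show ?thesis by (simp only: mult.assoc)
qed

end
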